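(* Let $n\geq 1$ be an integer, let $\alpha\in[2,\infty)$, and for $\xi=(\xi_1,\dots,\xi_n)\in\mathbb{R}^n$ define $$o^{\mathrm{p}}(\xi;\alpha)=\Bigl(\frac1n\sum_{i=1}^n|\xi_i|^\alpha\Bigr)^{1/\alpha}.$$ Let $\tilde\xi\in\mathbb{R}^n$ with $\tilde\xi\neq 0$, and let $o^{\mathrm{p}}_{\mathrm{lin}}(\cdot\,;\tilde\xi,\alpha)$ denote the linearization of $o^{\mathrm{p}}(\cdot\,;\alpha)$ at the linearization point $\tilde\xi$. Then $$o^{\mathrm{p}}_{\mathrm{lin}}(\gamma\tilde\xi;\tilde\xi,\alpha)=o^{\mathrm{p}}(\gamma\tilde\xi;\alpha)\qquad\text{for all }\gamma\in[0,1].$$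
   Context: The linearization of $o^{\mathrm{p}}(\cdot\,;\alpha)$ at $\tilde\xi$ is its first-order Taylor expansion in $\xi$: $o^{\mathrm{p}}_{\mathrm{lin}}(\xi;\tilde\xi,\alpha)=o^{\mathrm{p}}(\tilde\xi;\alpha)+\nabla_\xi o^{\mathrm{p}}(\tilde\xi;\alpha)^\top(\xi-\tilde\xi)$. *)

theory Defs
  imports "HOL-Analysis.Analysis"
begin

definition o_p :: "real \<Rightarrow> real ^ 'n \<Rightarrow> real" where
  "o_p \<alpha> \<xi> = ((1 / real CARD('n)) * (\<Sum>i\<in>UNIV. \<bar>\<xi> $ i\<bar> powr \<alpha>)) powr (1 / \<alpha>)"

(* Unspecified where f is not differentiable. *)
definition gradient :: "('a::real_inner \<Rightarrow> real) \<Rightarrow> 'a \<Rightarrow> 'a" where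
  "gradient f x = (THE D. GDERIV f x :> D)"

definition linearization :: "('a::real_inner \<Rightarrow> real) \<Rightarrow> 'a \<Rightarrow> 'a \<Rightarrow> real" where
  "linearization f x0 x = f x0 + gradient f x0 \<bullet> (x - x0)"

end

(* o_p is positively homogeneous of degree one and, since \<alpha> > 1, differentiable away from the
   origin.  Euler's identity then gives gradient (o_p \<alpha>) \<xi> \<bullet> \<xi> = o_p \<alpha> \<xi>, so that the linearization
   at \<xi> is itself linear along the ray through \<xi>. *)
theory Submission
  imports Defs
begin

text \<open>Makes the definite description in \<open>gradient\<close> computable: derivatives are
  unique, and a vector is determined by its inner products with all vectors.\<close>

lemma gradient_eqI:
  assumes "GDERIV f x :> D"
  shows "gradient f x = D"
  unfolding gradient_def
proof (rule the_equality)
  fix D' assume "GDERIV f x :> D'"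
  with assms have "(\<lambda>h. h \<bullet> D') = (\<lambda>h. h \<bullet> D)"
    unfolding gderiv_def by (rule has_derivative_unique[rotated])
  then have "h \<bullet> D' = h \<bullet> D" for h
    by metis
  then show "D' = D"
    by (metis vector_eq_ldot)
qed (fact assms)

text \<open>Riesz representation in finite dimension: a linear functional \<open>f'\<close> is the
  inner product with \<open>adjoint f' 1\<close>, so every derivative comes from a gradient
  vector.\<close>

lemma GDERIV_gradient:
  fixes f :: "'a::euclidean_space \<Rightarrow> real"
  assumes "f differentiable (at x)"
  shows "GDERIV f x :> gradient f x"
proof -
  from assms obtain f' where f': "(f has_derivative f') (at x)"
    by (auto simp: differentiable_def)
  have "f' h = h \<bullet> adjoint f' 1" for h
    using adjoint_works[OF has_derivative_linear[OF f'], of h 1] by simp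
  then have "f' = (\<lambda>h. h \<bullet> adjoint f' 1)"
    by (rule ext)
  with f' have "GDERIV f x :> adjoint f' 1"
    by (simp add: gderiv_def)
  then show ?thesis
    by (simp add: gradient_eqI)
qed

text \<open>Differentiate \<open>f (t *\<^sub>R x)\<close> at t = 1 in two ways: by the chain rule,
  and as the linear function \<open>t * f x\<close> that homogeneity gives.\<close>

lemma gradient_inner_self_if_homogeneous:
  fixes f :: "'a::euclidean_space \<Rightarrow> real"
  assumes diff: "f differentiable (at x)"
    and hom: "\<And>t. 0 < t \<Longrightarrow> f (t *\<^sub>R x) = t * f x"
  shows "gradient f x \<bullet> x = f x"
proof -
  \<comment> \<open>The base point is written \<open>1 *\<^sub>R x\<close> so that it matches the
    value of the ray at t = 1 in the chain rule.\<close>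
  have f: "(f has_derivative (\<lambda>h. h \<bullet> gradient f x)) (at (1 *\<^sub>R x))"
    using GDERIV_gradient[OF diff] by (simp add: gderiv_def)
  have "((\<lambda>t. t *\<^sub>R x) has_derivative (\<lambda>t. t *\<^sub>R x)) (at (1::real))"
    by (auto intro!: derivative_eq_intros)
  from has_derivative_compose[OF this f]
  have along: "((\<lambda>t. f (t *\<^sub>R x)) has_real_derivative (x \<bullet> gradient f x)) (at 1)"
    by (simp add: has_field_derivative_def mult_commute_abs)
  have "((\<lambda>t. t * f x) has_real_derivative f x) (at 1)"
    by (auto intro!: derivative_eq_intros)
  \<comment> \<open>Homogeneity holds for t > 0, an open neighbourhood of 1, which is enough to
    transfer the derivative.\<close>
  then have "((\<lambda>t. f (t *\<^sub>R x)) has_real_derivative f x) (at 1)"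
    by (rule has_field_derivative_transform_within_open[where S = "{0<..}"]) (auto simp: hom)
  with along show ?thesis
    by (simp add: DERIV_unique inner_commute)
qed

text \<open>Away from 0 the sign of x is locally constant and the power rule applies. At 0 the
  difference quotient has absolute value \<open>\<bar>h\<bar> powr (a - 1)\<close>, which vanishes
  in the limit because a > 1. This case covers vanishing coordinates of \<xi>.\<close>

lemma differentiable_abs_powr:
  fixes x :: real
  assumes "1 < a"
  shows "(\<lambda>x. \<bar>x\<bar> powr a) differentiable (at x)"
proof -
  consider "x = 0" | "x > 0" | "x < 0" by linarith
  then have "\<exists>D. ((\<lambda>x. \<bar>x\<bar> powr a) has_real_derivative D) (at x)"
  proof cases
    case 1
    have "((\<lambda>h::real. \<bar>h\<bar> powr (a - 1)) \<longlongrightarrow> 0) (at 0)"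
      using assms by (intro tendsto_zero_powrI) (auto intro!: tendsto_eq_intros)
    \<comment> \<open>Taking norms removes the sign of h. At h = 0 both sides are 0, by the
      conventions for division by zero and for \<open>0 powr _\<close>.\<close>
    moreover have "norm (\<bar>h\<bar> powr a / h) = \<bar>h\<bar> powr (a - 1)" for h :: real
      by (cases "h = 0") (auto simp: powr_diff)
    ultimately have "((\<lambda>h::real. \<bar>h\<bar> powr a / h) \<longlongrightarrow> 0) (at 0)"
      by (subst tendsto_norm_zero_iff[symmetric]) simp
    then show ?thesis
      using 1 assms by (intro exI[of _ 0]) (simp add: DERIV_def)
  next
    case 2
    then have "((\<lambda>x. x powr a) has_real_derivative a * x powr (a - 1)) (at x)"
      by (rule has_real_derivative_powr)
    then have "((\<lambda>x. \<bar>x\<bar> powr a) has_real_derivative a * x powr (a - 1)) (at x)"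
      by (rule has_field_derivative_transform_within_open[where S = "{0<..}"]) (use 2 in auto)
    then show ?thesis by blast
  next
    case 3
    then have "((\<lambda>x. (- x) powr a) has_real_derivative - (a * (- x) powr (a - 1))) (at x)"
      by (auto intro!: derivative_eq_intros)
    then have "((\<lambda>x. \<bar>x\<bar> powr a) has_real_derivative - (a * (- x) powr (a - 1))) (at x)"
      by (rule has_field_derivative_transform_within_open[where S = "{..<0}"]) (use 3 in auto)
    then show ?thesis by blast
  qed
  then show ?thesis
    by (auto simp: real_differentiable_def)
qed

text \<open>The outer power is differentiable only where its argument, the mean
  \<open>m \<xi>\<close>, is known to be positive; a nonzero coordinate of \<xi> ensures
  this.\<close>

lemma differentiable_o_p:
  fixes \<xi> :: "real ^ 'n"
  assumes "1 < \<alpha>" and "\<xi> \<noteq> 0"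
  shows "o_p \<alpha> differentiable (at \<xi>)"
proof -
  define m :: "real ^ 'n \<Rightarrow> real"
    where "m \<xi> = (1 / real CARD('n)) * (\<Sum>i\<in>UNIV. \<bar>\<xi> $ i\<bar> powr \<alpha>)" for \<xi>
  obtain i where "\<xi> $ i \<noteq> 0"
    using \<open>\<xi> \<noteq> 0\<close> by (auto simp: vec_eq_iff)
  then have "0 < (\<Sum>i\<in>UNIV. \<bar>\<xi> $ i\<bar> powr \<alpha>)"
    by (intro sum_pos2[where i = i]) auto
  then have "0 < m \<xi>"
    by (simp add: m_def)
  have "(\<lambda>\<xi>. \<xi> $ i) differentiable (at \<xi>)" for i
    using bounded_linear_vec_nth by (rule bounded_linear_imp_differentiable)
  then have "(\<lambda>\<xi>. \<bar>\<xi> $ i\<bar> powr \<alpha>) differentiable (at \<xi>)" for i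
    by (rule differentiable_compose[where f = "\<lambda>x. \<bar>x\<bar> powr \<alpha>", OF differentiable_abs_powr[OF \<open>1 < \<alpha>\<close>]])
  then have "m differentiable (at \<xi>)"
    unfolding m_def by (intro differentiable_mult differentiable_sum) auto
  moreover have "(\<lambda>x. x powr (1 / \<alpha>)) differentiable (at (m \<xi>))"
    using has_real_derivative_powr[OF \<open>0 < m \<xi>\<close>] by (auto simp: real_differentiable_def)
  ultimately have "(\<lambda>\<xi>. m \<xi> powr (1 / \<alpha>)) differentiable (at \<xi>)"
    by (rule differentiable_compose[rotated])
  then show ?thesis
    by (simp add: o_p_def[abs_def] m_def)
qed

text \<open>Allowing t = 0 covers the endpoint \<gamma> = 0 of the theorem; Euler's identity uses
  only t > 0.\<close>

lemma o_p_scaleR: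
  assumes "0 \<le> t" and "\<alpha> \<noteq> 0"
  shows "o_p \<alpha> (t *\<^sub>R \<xi>) = t * o_p \<alpha> \<xi>"
proof -
  let ?S = "\<Sum>i\<in>UNIV. \<bar>\<xi> $ i\<bar> powr \<alpha>"
  have "(\<Sum>i\<in>UNIV. \<bar>(t *\<^sub>R \<xi>) $ i\<bar> powr \<alpha>) = t powr \<alpha> * ?S"
    using assms by (simp add: abs_mult powr_mult sum_distrib_left)
  then have "o_p \<alpha> (t *\<^sub>R \<xi>) = (t powr \<alpha> * (1 / real CARD('a) * ?S)) powr (1 / \<alpha>)"
    by (simp add: o_p_def)
  also have "\<dots> = (t powr \<alpha>) powr (1 / \<alpha>) * o_p \<alpha> \<xi>"
    unfolding o_p_def by (rule powr_mult)
  also have "(t powr \<alpha>) powr (1 / \<alpha>) = t"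
    using assms by (simp add: powr_powr)
  finally show ?thesis .
qed

theorem mainTheorem2:
  fixes \<alpha> :: real and \<xi>0 :: "real ^ 'n"
  assumes "2 \<le> \<alpha>" and "\<xi>0 \<noteq> 0"
  shows "\<forall>\<gamma>\<in>{0..1::real}. linearization (o_p \<alpha>) \<xi>0 (\<gamma> *\<^sub>R \<xi>0) = o_p \<alpha> (\<gamma> *\<^sub>R \<xi>0)"
proof
  fix \<gamma> :: real assume "\<gamma> \<in> {0..1}"
  then have "o_p \<alpha> (\<gamma> *\<^sub>R \<xi>0) = \<gamma> * o_p \<alpha> \<xi>0"
    using assms by (intro o_p_scaleR) auto
  moreover have "gradient (o_p \<alpha>) \<xi>0 \<bullet> \<xi>0 = o_p \<alpha> \<xi>0"
    using assms by (intro gradient_inner_self_if_homogeneous differentiable_o_p o_p_scaleR) auto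
  \<comment> \<open>Since \<open>\<gamma> *\<^sub>R \<xi>0 - \<xi>0\<close> is (\<gamma> - 1) times
    \<open>\<xi>0\<close>, the linear term equals (\<gamma> - 1) times
    \<open>o_p \<alpha> \<xi>0\<close>, and the total is
    \<open>\<gamma> * o_p \<alpha> \<xi>0\<close>.\<close>
  ultimately show "linearization (o_p \<alpha>) \<xi>0 (\<gamma> *\<^sub>R \<xi>0) = o_p \<alpha> (\<gamma> *\<^sub>R \<xi>0)"
    by (simp add: linearization_def inner_diff_right algebra_simps)
qed

end
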